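(* Let $m\ge 1$ and, for $i,j=1,\dots,m$, let $A_i\ge\alpha_i>0$, $\tau_i\ge 0$, $\sigma_{ij}\ge 0$, $L_{ij}\ge 0$ be constants. Consider the system $$\dot{x}_i(t)=-a_i(t)x_i(h_i(t))+\sum_{j=1}^m F_{ij}\bigl(t,x_j(g_{ij}(t))\bigr),\qquad t\ge t_0,\ i=1,\dots,m,$$ with $t_0\ge 0$ arbitrary and initial conditions $x_i(t)=\varphi_i(t)$, $t\le t_0$, under the assumptions: (i) $a_i$ are Lebesgue measurable essentially bounded functions on $[0,\infty)$ with $\alpha_i\le a_i(t)\le A_i$; (ii) $F_{ij}(t,\cdot)$ are continuous, $F_{ij}(\cdot,u)$ are measurable and locally essentially bounded, and $|F_{ij}(t,u)|\le L_{ij}|u|$ for $t\ge 0$ and $u\in\mathbb{R}$; (iii) $h_i,g_{ij}$ are measurable functions with $0\le t-h_i(t)\le\tau_i$ and $0\le t-g_{ij}(t)\le\sigma_{ij}$; (iv) $\varphi_i$ are continuous on $[t_0-\sigma,t_0]$, where $\sigma=\max\{\tau_k,\sigma_{ij}: i,j,k=1,\dots,m\}$; (v) each such initial value problem has a unique solution on $[t_0,\infty)$. Define the matrix $C=(c_{ij})_{i,j=1}^m$ by $$c_{ii}=1-\frac{A_i(A_i+L_{ii})\tau_i+L_{ii}}{\alpha_i},\qquad c_{ij}=-\frac{A_iL_{ij}\tau_i+L_{ij}}{\alpha_i}\quad(i\ne j).$$ If $C$ is an $M$-matrix, then the system is globally exponentially stable.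
   Context: A solution $X=(x_1,\dots,x_m)^T$ of the initial value problem is a function, locally absolutely continuous on $[t_0,\infty)$, satisfying the differential system almost everywhere for $t>t_0$ and the initial conditions for $t\le t_0$ (that is, on $[t_0-\sigma,t_0]$). $M$-matrix: a real square matrix $B=(b_{ij})$ is a (nonsingular) $M$-matrix if $b_{ij}\le 0$ for $i\ne j$ and all principal minors of $B$ are positive (equivalently, given the sign condition, $B$ is invertible with entrywise nonnegative inverse). Global exponential stability: there exist $M>0$, $\lambda>0$, not depending on $t_0$, such that for every $t_0\ge 0$ and every initial function $\varphi=(\varphi_1,\dots,\varphi_m)^T$ the solution $X$ satisfies $$\|X(t)\|\le Me^{-\lambda(t-t_0)}\Bigl(\|X(t_0)\|+\sup_{t_0-\sigma\le s<t_0}\|\varphi(s)\|\Bigr),\qquad t\ge t_0,$$ where $\|\cdot\|$ is a fixed norm on $\mathbb{R}^m$ (the supremum over an empty set is read as $0$). *)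

theory Defs
  imports "HOL-Analysis.Analysis"
begin

text \<open>
  Leibniz formula for the determinant of the submatrix of \<open>B\<close> with row and column index
  set \<open>S\<close>; for \<open>S = UNIV\<close> it is literally the definition of \<^const>\<open>det\<close>.
\<close>
definition principal_minor :: "real^'n^'n \<Rightarrow> 'n set \<Rightarrow> real" where
  "principal_minor B S = (\<Sum>p | p permutes S. of_int (sign p) * (\<Prod>i\<in>S. B $ i $ p i))"

definition M_matrix :: "real^'n^'n \<Rightarrow> bool" where
  "M_matrix B \<longleftrightarrow>
     (\<forall>i j. i \<noteq> j \<longrightarrow> B $ i $ j \<le> 0) \<and> (\<forall>S. S \<noteq> {} \<longrightarrow> principal_minor B S > 0)"

definition is_norm :: "('a::real_vector \<Rightarrow> real) \<Rightarrow> bool" where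
  "is_norm N \<longleftrightarrow>
     (\<forall>x. N x = 0 \<longleftrightarrow> x = 0) \<and> (\<forall>c x. N (c *\<^sub>R x) = \<bar>c\<bar> * N x) \<and>
     (\<forall>x y. N (x + y) \<le> N x + N y)"

text \<open>
  A division \<open>d\<close> is a finite set of nonempty compact intervals with pairwise disjoint interiors;
  the interval \<open>k\<close> has the endpoints \<open>Inf k\<close> and \<open>Sup k\<close>.
\<close>
definition absolutely_continuous_on :: "real set \<Rightarrow> (real \<Rightarrow> 'a::real_normed_vector) \<Rightarrow> bool" where
  "absolutely_continuous_on S f \<longleftrightarrow>
     (\<forall>\<epsilon>>0. \<exists>\<delta>>0. \<forall>d. d division_of \<Union>d \<and> \<Union>d \<subseteq> S \<and> (\<Sum>k\<in>d. Sup k - Inf k) < \<delta> \<longrightarrow>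
        (\<Sum>k\<in>d. norm (f (Sup k) - f (Inf k))) < \<epsilon>)"

definition locally_absolutely_continuous_on ::
    "real set \<Rightarrow> (real \<Rightarrow> 'a::real_normed_vector) \<Rightarrow> bool" where
  "locally_absolutely_continuous_on S f \<longleftrightarrow>
     (\<forall>a b. {a..b} \<subseteq> S \<longrightarrow> absolutely_continuous_on {a..b} f)"

definition essentially_bounded_on :: "real set \<Rightarrow> (real \<Rightarrow> real) \<Rightarrow> bool" where
  "essentially_bounded_on S f \<longleftrightarrow> (\<exists>K. AE t in lebesgue_on S. \<bar>f t\<bar> \<le> K)"

definition locally_essentially_bounded_on :: "real set \<Rightarrow> (real \<Rightarrow> real) \<Rightarrow> bool" where
  "locally_essentially_bounded_on S f \<longleftrightarrow>
     (\<forall>a b. {a..b} \<subseteq> S \<longrightarrow> essentially_bounded_on {a..b} f)"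

definition max_delay :: "('n::finite \<Rightarrow> real) \<Rightarrow> ('n \<Rightarrow> 'n \<Rightarrow> real) \<Rightarrow> real" where
  "max_delay \<tau> \<sigma> = Max (range \<tau> \<union> {\<sigma> i j | i j. True})"

definition delay_rhs ::
    "('n::finite \<Rightarrow> real \<Rightarrow> real) \<Rightarrow> ('n \<Rightarrow> real \<Rightarrow> real) \<Rightarrow> ('n \<Rightarrow> 'n \<Rightarrow> real \<Rightarrow> real \<Rightarrow> real) \<Rightarrow>
     ('n \<Rightarrow> 'n \<Rightarrow> real \<Rightarrow> real) \<Rightarrow> (real \<Rightarrow> real^'n) \<Rightarrow> real \<Rightarrow> real^'n" where
  "delay_rhs a h F g X t =
     (\<chi> i. - a i t * X (h i t) $ i + (\<Sum>j\<in>UNIV. F i j t (X (g i j t) $ j)))"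

text \<open>
  Below, \<open>s\<close> is the maximal delay. A solution is represented by a total function of which only
  the values on \<open>[t0 - s, \<infinity>)\<close> matter.
\<close>
definition is_solution ::
    "('n::finite \<Rightarrow> real \<Rightarrow> real) \<Rightarrow> ('n \<Rightarrow> real \<Rightarrow> real) \<Rightarrow> ('n \<Rightarrow> 'n \<Rightarrow> real \<Rightarrow> real \<Rightarrow> real) \<Rightarrow>
     ('n \<Rightarrow> 'n \<Rightarrow> real \<Rightarrow> real) \<Rightarrow> real \<Rightarrow> real \<Rightarrow> (real \<Rightarrow> real^'n) \<Rightarrow> (real \<Rightarrow> real^'n) \<Rightarrow> bool" where
  "is_solution a h F g s t0 \<phi> X \<longleftrightarrow>
     locally_absolutely_continuous_on {t0..} X \<and>
     (AE t in lebesgue_on {t0<..}. (X has_vector_derivative delay_rhs a h F g X t) (at t)) \<and>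
     (\<forall>t\<in>{t0 - s..t0}. X t = \<phi> t)"

definition uniquely_solvable ::
    "('n::finite \<Rightarrow> real \<Rightarrow> real) \<Rightarrow> ('n \<Rightarrow> real \<Rightarrow> real) \<Rightarrow> ('n \<Rightarrow> 'n \<Rightarrow> real \<Rightarrow> real \<Rightarrow> real) \<Rightarrow>
     ('n \<Rightarrow> 'n \<Rightarrow> real \<Rightarrow> real) \<Rightarrow> real \<Rightarrow> bool" where
  "uniquely_solvable a h F g s \<longleftrightarrow>
     (\<forall>t0\<ge>0. \<forall>\<phi>. continuous_on {t0 - s..t0} \<phi> \<longrightarrow>
        (\<exists>X. is_solution a h F g s t0 \<phi> X \<and>
             (\<forall>Y. is_solution a h F g s t0 \<phi> Y \<longrightarrow> (\<forall>t\<ge>t0. Y t = X t))))"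

definition sup_on :: "real set \<Rightarrow> (real \<Rightarrow> real) \<Rightarrow> real" where
  "sup_on S f = (if S = {} then 0 else (SUP t\<in>S. f t))"

definition globally_exponentially_stable ::
    "(real^'n \<Rightarrow> real) \<Rightarrow> ('n::finite \<Rightarrow> real \<Rightarrow> real) \<Rightarrow> ('n \<Rightarrow> real \<Rightarrow> real) \<Rightarrow>
     ('n \<Rightarrow> 'n \<Rightarrow> real \<Rightarrow> real \<Rightarrow> real) \<Rightarrow> ('n \<Rightarrow> 'n \<Rightarrow> real \<Rightarrow> real) \<Rightarrow> real \<Rightarrow> bool" where
  "globally_exponentially_stable N a h F g s \<longleftrightarrow>
     (\<exists>M>0. \<exists>\<gamma>>0. \<forall>t0\<ge>0. \<forall>\<phi>. continuous_on {t0 - s..t0} \<phi> \<longrightarrow>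
        (\<forall>X. is_solution a h F g s t0 \<phi> X \<longrightarrow>
           (\<forall>t\<ge>t0. N (X t) \<le>
              M * exp (- \<gamma> * (t - t0)) * (N (X t0) + sup_on {t0 - s..<t0} (\<lambda>u. N (\<phi> u))))))"

definition stability_matrix ::
    "('n::finite \<Rightarrow> real) \<Rightarrow> ('n \<Rightarrow> real) \<Rightarrow> ('n \<Rightarrow> real) \<Rightarrow> ('n \<Rightarrow> 'n \<Rightarrow> real) \<Rightarrow> real^'n^'n" where
  "stability_matrix \<alpha> A \<tau> L =
     (\<chi> i j. if i = j then 1 - (A i * (A i + L i i) * \<tau> i + L i i) / \<alpha> i
             else - (A i * L i j * \<tau> i + L i j) / \<alpha> i)"

end

theory Submission
  imports Defs
begin

text \<open>
  The proof compares the solution with a decaying exponential barrier. An M-matrix \<open>C\<close> admits a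
  positive vector \<open>d\<close> with \<open>C d > 0\<close> (\<open>M_matrix_obtain_positive_vector\<close>). Multiplied by \<open>\<alpha> i\<close>, the
  \<open>i\<close>-th inequality reads
  \<open>A i \<tau> i (A i d i + \<Sum>j. L i j d j) + (\<Sum>j. L i j d j) < \<alpha> i d i\<close>. To read it dynamically, write the
  \<open>i\<close>-th equation as \<open>x' = - a x(t) + a (x(t) - x(h(t))) + \<Sum>j. F\<close>. If all components are bounded by
  \<open>d j\<close>, the derivative of \<open>x\<close> is at most \<open>A i d i + \<Sum>j. L i j d j\<close>, so the perturbation of
  \<open>x' = - a x(t)\<close> is bounded by the left-hand side, while the damping is at least \<open>\<alpha> i d i\<close> when
  \<open>\<bar>x\<bar> = d i\<close>: the box with the sides \<open>d j\<close> cannot be left.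

  The inequalities are strict, so they persist with a small exponential weight
  (\<open>obtain_decay_rate\<close>): the box may shrink like \<open>exp (- \<gamma> (t - t0))\<close>, where the delays cost factors
  \<open>exp (\<gamma> s)\<close> with the maximal delay \<open>s\<close>. Near \<open>t0\<close> the lag also involves the initial function, whose
  size is bounded but whose slope is not; taking the box large compared with the initial data absorbs
  this. The lemma \<open>solution_decay\<close> carries out the comparison by looking at the first time when the
  barrier is reached. Its only analytic tool is that an absolutely continuous function with derivative
  almost everywhere at most \<open>c\<close> grows at most at the rate \<open>c\<close>
  (\<open>absolutely_continuous_on_deriv_le_imp_increment_le\<close>). The passage from
  components to the given norm is the equivalence of norms in finite dimension.
\<close>

section \<open>Increments of absolutely continuous functions\<close>

lemma absolutely_continuous_on_obtain:
  assumes "absolutely_continuous_on S f" "\<epsilon> > 0"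
  obtains \<delta> where "\<delta> > 0"
    "\<And>d. d division_of \<Union>d \<Longrightarrow> \<Union>d \<subseteq> S \<Longrightarrow> (\<Sum>k\<in>d. Sup k - Inf k) < \<delta> \<Longrightarrow>
        (\<Sum>k\<in>d. norm (f (Sup k) - f (Inf k))) < \<epsilon>"
proof -
  from mp[OF spec[OF assms(1)[unfolded absolutely_continuous_on_def]] assms(2)]
  obtain \<delta> where "\<delta> > 0" and \<delta>: "\<forall>d. d division_of \<Union>d \<and> \<Union>d \<subseteq> S \<and> (\<Sum>k\<in>d. Sup k - Inf k) < \<delta> \<longrightarrow>
        (\<Sum>k\<in>d. norm (f (Sup k) - f (Inf k))) < \<epsilon>" by (elim exE conjE)
  show thesis
    by (rule that[OF \<open>\<delta> > 0\<close>]) (rule mp[OF spec[OF \<delta>]], intro conjI)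
qed

lemma absolutely_continuous_on_linear_image:
  assumes f: "absolutely_continuous_on S f" and T: "bounded_linear T"
  shows "absolutely_continuous_on S (\<lambda>t. T (f t))"
  unfolding absolutely_continuous_on_def
proof (intro allI impI)
  fix \<epsilon> :: real assume "\<epsilon> > 0"
  obtain K where K: "K > 0" "\<And>x. norm (T x) \<le> norm x * K"
    using bounded_linear.pos_bounded[OF T] by blast
  with \<open>\<epsilon> > 0\<close> have "\<epsilon> / K > 0" by simp
  obtain \<delta> where \<delta>: "\<delta> > 0"
    "\<And>d. d division_of \<Union>d \<Longrightarrow> \<Union>d \<subseteq> S \<Longrightarrow> (\<Sum>k\<in>d. Sup k - Inf k) < \<delta> \<Longrightarrow>
        (\<Sum>k\<in>d. norm (f (Sup k) - f (Inf k))) < \<epsilon> / K"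
    by (rule absolutely_continuous_on_obtain[OF f \<open>\<epsilon> / K > 0\<close>]) (rule that)
  have "(\<Sum>k\<in>d. norm (T (f (Sup k)) - T (f (Inf k)))) < \<epsilon>"
    if "d division_of \<Union>d" "\<Union>d \<subseteq> S" "(\<Sum>k\<in>d. Sup k - Inf k) < \<delta>" for d
  proof -
    have "(\<Sum>k\<in>d. norm (T (f (Sup k)) - T (f (Inf k))))
        \<le> (\<Sum>k\<in>d. norm (f (Sup k) - f (Inf k))) * K"
      unfolding sum_distrib_right
      by (intro sum_mono) (metis K(2) T bounded_linear.linear linear_diff)
    also have "\<dots> < \<epsilon>" using \<delta>(2)[OF that] K(1) by (simp add: field_simps)
    finally show ?thesis .
  qed
  then show "\<exists>\<delta>>0. \<forall>d. d division_of \<Union>d \<and> \<Union>d \<subseteq> S \<and> (\<Sum>k\<in>d. Sup k - Inf k) < \<delta> \<longrightarrow>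
      (\<Sum>k\<in>d. norm (T (f (Sup k)) - T (f (Inf k)))) < \<epsilon>"
    by (intro exI[of _ \<delta>] conjI[OF \<delta>(1)] allI impI) (elim conjE)
qed

lemma absolutely_continuous_on_imp_continuous_on:
  assumes "absolutely_continuous_on {a..b} f"
  shows "continuous_on {a..b} f"
  unfolding continuous_on_iff
proof (intro ballI allI impI)
  fix x \<epsilon> :: real assume x: "x \<in> {a..b}" and "\<epsilon> > 0"
  obtain \<delta> where \<delta>: "\<delta> > 0"
    "\<And>d. d division_of \<Union>d \<Longrightarrow> \<Union>d \<subseteq> {a..b} \<Longrightarrow> (\<Sum>k\<in>d. Sup k - Inf k) < \<delta> \<Longrightarrow>
        (\<Sum>k\<in>d. norm (f (Sup k) - f (Inf k))) < \<epsilon>"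
    by (rule absolutely_continuous_on_obtain[OF assms \<open>\<epsilon> > 0\<close>]) (rule that)
  have *: "norm (f v - f u) < \<epsilon>" if "u \<in> {a..b}" "v \<in> {a..b}" "u \<le> v" "v - u < \<delta>" for u v
  proof -
    have "{{u..v}} division_of \<Union>{{u..v}}"
      using that(3) division_of_self[of u v] by simp
    moreover have "\<Union>{{u..v}} \<subseteq> {a..b}" using that by auto
    ultimately show ?thesis using \<delta>(2)[of "{{u..v}}"] that by simp
  qed
  have "dist (f y) (f x) < \<epsilon>" if "y \<in> {a..b}" "dist y x < \<delta>" for y
    using *[of x y] *[of y x] that x by (cases "x \<le> y") (auto simp: dist_norm norm_minus_commute)
  with \<delta>(1) show "\<exists>d>0. \<forall>y\<in>{a..b}. dist y x < d \<longrightarrow> dist (f y) (f x) < \<epsilon>" by blast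
qed

text \<open>
  Straddling: both end points are compared with the tag \<open>x\<close>, which lies between them, so the two
  errors add up to a multiple of the length \<open>v - u\<close>.
\<close>
lemma real_derivative_straddle:
  fixes f :: "real \<Rightarrow> real"
  assumes "(f has_real_derivative D) (at x)" "e > 0"
  obtains d where "d > 0"
    "\<And>u v. u \<le> x \<Longrightarrow> x \<le> v \<Longrightarrow> u \<in> ball x d \<Longrightarrow> v \<in> ball x d \<Longrightarrow> f v - f u \<le> (D + e) * (v - u)"
proof -
  from assms obtain d where d: "d > 0"
    and *: "\<And>y. \<bar>y - x\<bar> < d \<Longrightarrow> \<bar>f y - f x - D * (y - x)\<bar> \<le> e * \<bar>y - x\<bar>"
    unfolding has_field_derivative_def has_derivative_at_alt by (auto simp: real_norm_def)
  have "f v - f u \<le> (D + e) * (v - u)"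
    if "u \<le> x" "x \<le> v" "u \<in> ball x d" "v \<in> ball x d" for u v
  proof -
    have "\<bar>u - x\<bar> < d" "\<bar>v - x\<bar> < d" using that by (auto simp: dist_real_def)
    from *[OF this(1)] *[OF this(2)] that(1,2) show ?thesis
      by (simp add: abs_le_iff algebra_simps)
  qed
  with d that show thesis by blast
qed

text \<open>
  Absolute continuity is exactly what makes the exceptional null set harmless. Cover it by an open
  set of small measure and choose a gauge that, at exceptional tags, stays inside this open set and,
  at the other tags, makes the difference quotients at most \<open>c + \<epsilon>\<close>. In a fine tagged division the
  intervals with exceptional tags have small total length, so by absolute continuity they contribute
  little to the telescoping sum for \<open>f b - f a\<close>; the other intervals contribute at most
  \<open>(c + \<epsilon>) * (b - a)\<close> up to a small error.
\<close>
lemma absolutely_continuous_on_deriv_le_imp_increment_le: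
  fixes f :: "real \<Rightarrow> real"
  assumes "a \<le> b" and ac: "absolutely_continuous_on {a..b} f" and "negligible Z"
    and deriv: "\<And>t. a < t \<Longrightarrow> t < b \<Longrightarrow> t \<notin> Z \<Longrightarrow> \<exists>D\<le>c. (f has_real_derivative D) (at t)"
  shows "f b - f a \<le> c * (b - a)"
proof -
  \<comment> \<open>The end points join the exceptional set, since no derivative is given there.\<close>
  define Z' where "Z' = Z \<union> {a, b}"
  have "negligible Z'" unfolding Z'_def using \<open>negligible Z\<close> by (simp add: negligible_Un_eq)
  have bound: "f b - f a - c * (b - a) \<le> \<epsilon> * ((b - a) + 1 + \<bar>c\<bar>)" if "\<epsilon> > 0" for \<epsilon>
  proof -
    obtain \<delta> where \<delta>: "\<delta> > 0"
      "\<And>d. d division_of \<Union>d \<Longrightarrow> \<Union>d \<subseteq> {a..b} \<Longrightarrow> (\<Sum>k\<in>d. Sup k - Inf k) < \<delta> \<Longrightarrow>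
        (\<Sum>k\<in>d. norm (f (Sup k) - f (Inf k))) < \<epsilon>"
      by (rule absolutely_continuous_on_obtain[OF ac \<open>\<epsilon> > 0\<close>]) (rule that)
    \<comment> \<open>The bound by \<open>\<epsilon>\<close> controls the linear part \<open>c * t\<close> on
      the exceptional intervals.\<close>
    define \<eta> where "\<eta> = min \<delta> \<epsilon>"
    have "\<eta> > 0" using \<delta>(1) \<open>\<epsilon> > 0\<close> by (simp add: \<eta>_def)
    obtain U where U: "open U" "Z' \<subseteq> U" "U \<in> lmeasurable" "measure lebesgue U < \<eta>"
    proof -
      have "Z' \<in> sets lebesgue" using \<open>negligible Z'\<close> negligible_imp_sets by blast
      then obtain U where U: "open U" "Z' \<subseteq> U" "(U - Z') \<in> lmeasurable" "emeasure lebesgue (U - Z') < ennreal \<eta>"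
        using sets_lebesgue_outer_open \<open>\<eta> > 0\<close> by metis
      moreover have "U = (U - Z') \<union> Z'" using U(2) by auto
      moreover have "Z' \<in> lmeasurable" using \<open>negligible Z'\<close> negligible_iff_measure by blast
      ultimately have "U \<in> lmeasurable" by (metis fmeasurable.Un)
      moreover have "measure lebesgue U = measure lebesgue (U - Z')"
        using \<open>negligible Z'\<close> \<open>U \<in> lmeasurable\<close>
        by (simp add: measure_Diff_null_set negligible_iff_null_sets)
      moreover have "measure lebesgue (U - Z') < \<eta>"
        using U(3,4) by (simp add: emeasure_eq_measure2 \<open>\<eta> > 0\<close> ennreal_less_iff)
      ultimately show thesis using U that by simp
    qed
    have "\<exists>r>0. if x \<in> Z' then ball x r \<subseteq> U
        else x \<in> {a..b} \<longrightarrow> (\<forall>u v. u \<le> x \<longrightarrow> x \<le> v \<longrightarrow> u \<in> ball x r \<longrightarrow> v \<in> ball x r \<longrightarrow>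
               f v - f u \<le> (c + \<epsilon>) * (v - u))" for x
    proof (cases "x \<in> Z' \<or> x \<notin> {a..b}")
      case True
      then show ?thesis using U(1,2) open_contains_ball by (metis (full_types) subsetD zero_less_one)
    next
      case False
      then have "a < x" "x < b" "x \<notin> Z" by (auto simp: Z'_def)
      then obtain D where "D \<le> c" "(f has_real_derivative D) (at x)" using deriv by blast
      from real_derivative_straddle[OF this(2) \<open>\<epsilon> > 0\<close>] obtain r where r: "r > 0"
        "\<And>u v. u \<le> x \<Longrightarrow> x \<le> v \<Longrightarrow> u \<in> ball x r \<Longrightarrow> v \<in> ball x r \<Longrightarrow> f v - f u \<le> (D + \<epsilon>) * (v - u)"
        by blast
      have "f v - f u \<le> (c + \<epsilon>) * (v - u)"
        if "u \<le> x" "x \<le> v" "u \<in> ball x r" "v \<in> ball x r" for u v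
      proof -
        have "(D + \<epsilon>) * (v - u) \<le> (c + \<epsilon>) * (v - u)" using that \<open>D \<le> c\<close> by (intro mult_right_mono) auto
        with r(2)[OF that] show ?thesis by linarith
      qed
      with r(1) False show ?thesis by auto
    qed
    then obtain r where r: "\<And>x. r x > 0" and rZ: "\<And>x. x \<in> Z' \<Longrightarrow> ball x (r x) \<subseteq> U"
      and rD: "\<And>x u v. x \<notin> Z' \<Longrightarrow> x \<in> {a..b} \<Longrightarrow> u \<le> x \<Longrightarrow> x \<le> v \<Longrightarrow> u \<in> ball x (r x) \<Longrightarrow>
        v \<in> ball x (r x) \<Longrightarrow> f v - f u \<le> (c + \<epsilon>) * (v - u)"
      by metis
    have "gauge (\<lambda>x. ball x (r x))" using r by (simp add: gauge_ball_dependent)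
    then obtain p where p: "p tagged_division_of {a..b}" and fine: "(\<lambda>x. ball x (r x)) fine p"
      using fine_division_exists_real by blast
    note pD = tagged_division_ofD[OF p]
    have interval: "Inf K \<le> x \<and> x \<le> Sup K \<and> K = {Inf K..Sup K}" if xK: "(x, K) \<in> p" for x K
    proof -
      obtain u v where "K = {u..v}" using pD(4)[OF xK] by auto
      with pD(2)[OF xK] show ?thesis by auto
    qed
    define p1 where "p1 = {(x,K)\<in>p. x \<in> Z'}"
    define p2 where "p2 = {(x,K)\<in>p. x \<notin> Z'}"
    have p12: "p = p1 \<union> p2" "p1 \<inter> p2 = {}" "finite p1" "finite p2" "p1 \<subseteq> p"
      using pD(1) by (auto simp: p1_def p2_def intro: finite_subset[OF _ pD(1)])
    define G where "G = (\<lambda>K. f (Sup K) - f (Inf K) - c * (Sup K - Inf K))"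
    \<comment> \<open>Sums over tagged pairs become sums over intervals: two tags of one interval would force
      it to be degenerate, hence a single point.\<close>
    have inj: "inj_on snd p"
    proof (rule inj_onI)
      fix y z assume yz: "y \<in> p" "z \<in> p" "snd y = snd z"
      then obtain x x' K where y: "y = (x, K)" and z: "z = (x', K)" by (metis prod.collapse)
      with yz have xK: "(x, K) \<in> p" "(x', K) \<in> p" by simp_all
      have "x = x'"
      proof (rule ccontr)
        assume "x \<noteq> x'"
        then have "interior K = {}" using pD(5)[OF xK] by auto
        moreover have "interior K = {Inf K<..<Sup K}"
          using interval[OF xK(1)] interior_atLeastAtMost_real by metis
        ultimately have "Sup K \<le> Inf K" by simp
        with interval[OF xK(1)] interval[OF xK(2)] \<open>x \<noteq> x'\<close> show False by linarith
      qed
      then show "y = z" by (simp add: y z)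
    qed
    define d where "d = snd ` p1"
    have div: "d division_of \<Union>d" unfolding d_def
      using p p12(5) by (intro partial_division_of_tagged_division[of _ "{a..b}"])
        (auto simp: tagged_division_of_def intro: tagged_partial_division_subset)
    have d_mem: "\<exists>x. (x, K) \<in> p \<and> x \<in> Z'" if "K \<in> d" for K
      using that by (auto simp: d_def p1_def)
    have dsub: "\<Union>d \<subseteq> {a..b}" using pD(3) d_mem by (meson Union_least)
    have reindex: "(\<Sum>(x,K)\<in>p1. \<phi> K) = sum \<phi> d" for \<phi> :: "real set \<Rightarrow> real"
    proof -
      have "inj_on snd p1" using inj p12(5) inj_on_subset by blast
      then show ?thesis by (simp add: d_def sum.reindex split_def)
    qed
    have "(\<Sum>K\<in>d. Sup K - Inf K) = sum (measure lebesgue) d"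
    proof (rule sum.cong[OF refl])
      fix K assume "K \<in> d"
      then obtain x where "(x, K) \<in> p" using d_mem by blast
      with interval[OF this] have "Inf K \<le> Sup K" and K: "K = {Inf K..Sup K}" by auto
      moreover have "v - u = measure lebesgue {u..v}" if "u \<le> v" for u v :: real
        using that by simp
      ultimately show "Sup K - Inf K = measure lebesgue K" by metis
    qed
    also have "\<dots> = measure lebesgue (\<Union>d)" using content_division[OF div] by simp
    also have "\<dots> \<le> measure lebesgue U"
    proof (rule measure_mono_fmeasurable)
      show "\<Union>d \<subseteq> U"
      proof (rule Union_least)
        fix K assume "K \<in> d"
        then obtain x where "(x, K) \<in> p" "x \<in> Z'" using d_mem by blast
        with fine rZ show "K \<subseteq> U" by (fastforce simp: fine_def)
      qed
      show "\<Union>d \<in> sets lebesgue" using div lmeasurable_division by auto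
    qed (rule U(3))
    finally have len: "(\<Sum>K\<in>d. Sup K - Inf K) < \<eta>" using U(4) by simp
    have "(\<Sum>K\<in>d. \<bar>f (Sup K) - f (Inf K)\<bar>) < \<epsilon>"
      using \<delta>(2)[OF div dsub] len by (simp add: \<eta>_def)
    moreover have "sum G d \<le> (\<Sum>K\<in>d. \<bar>f (Sup K) - f (Inf K)\<bar>) + \<bar>c\<bar> * (\<Sum>K\<in>d. Sup K - Inf K)"
      unfolding sum_distrib_left sum.distrib[symmetric]
    proof (rule sum_mono)
      fix K assume "K \<in> d"
      then obtain x where "(x, K) \<in> p" using d_mem by blast
      then have "Inf K \<le> Sup K" using interval by force
      then have "\<bar>c * (Sup K - Inf K)\<bar> = \<bar>c\<bar> * (Sup K - Inf K)" by (simp add: abs_mult)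
      then show "G K \<le> \<bar>f (Sup K) - f (Inf K)\<bar> + \<bar>c\<bar> * (Sup K - Inf K)"
        unfolding G_def by linarith
    qed
    moreover have "\<bar>c\<bar> * (\<Sum>K\<in>d. Sup K - Inf K) \<le> \<bar>c\<bar> * \<epsilon>"
      using len by (intro mult_left_mono) (auto simp: \<eta>_def)
    ultimately have S1: "(\<Sum>(x,K)\<in>p1. G K) \<le> \<epsilon> + \<bar>c\<bar> * \<epsilon>" unfolding reindex by linarith
    have S2: "(\<Sum>(x,K)\<in>p2. G K) \<le> (\<Sum>(x,K)\<in>p2. \<epsilon> * (Sup K - Inf K))"
    proof (rule sum_mono, clarify)
      fix x K assume "(x, K) \<in> p2"
      then have xK: "(x, K) \<in> p" "x \<notin> Z'" by (auto simp: p2_def)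
      have sub: "K \<subseteq> ball x (r x)" using fine xK(1) by (auto simp: fine_def)
      have "f (Sup K) - f (Inf K) \<le> (c + \<epsilon>) * (Sup K - Inf K)"
      proof (rule rD[OF xK(2)])
        show "x \<in> {a..b}" using pD(2,3)[OF xK(1)] by auto
        show "Inf K \<le> x" "x \<le> Sup K" using interval[OF xK(1)] by auto
        then show "Inf K \<in> ball x (r x)" "Sup K \<in> ball x (r x)"
          using interval[OF xK(1)] sub by (metis atLeastAtMost_iff order_refl order_trans subsetD)+
      qed
      then show "G K \<le> \<epsilon> * (Sup K - Inf K)" by (simp add: G_def algebra_simps)
    qed
    also have "\<dots> \<le> (\<Sum>(x,K)\<in>p. \<epsilon> * (Sup K - Inf K))"
    proof (rule sum_mono2[OF pD(1)])
      show "p2 \<subseteq> p" by (simp add: p12)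
      fix y assume "y \<in> p - p2"
      then show "0 \<le> (case y of (x, K) \<Rightarrow> \<epsilon> * (Sup K - Inf K))"
        using interval \<open>\<epsilon> > 0\<close> by (cases y) (force intro: mult_nonneg_nonneg)
    qed
    also have "\<dots> = \<epsilon> * (b - a)"
      using additive_tagged_division_1[OF \<open>a \<le> b\<close> p, of "\<lambda>t. \<epsilon> * t"] by (simp add: algebra_simps)
    finally have "(\<Sum>(x,K)\<in>p2. G K) \<le> \<epsilon> * (b - a)" .
    moreover have "(\<Sum>(x,K)\<in>p. G K) = f b - f a - c * (b - a)"
      using additive_tagged_division_1[OF \<open>a \<le> b\<close> p, of "\<lambda>t. f t - c * t"]
      by (simp add: G_def algebra_simps)
    moreover have "(\<Sum>(x,K)\<in>p. G K) = (\<Sum>(x,K)\<in>p1. G K) + (\<Sum>(x,K)\<in>p2. G K)"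
      unfolding p12(1) by (rule sum.union_disjoint) (use p12 in auto)
    ultimately show ?thesis using S1 by (simp add: algebra_simps)
  qed
  define B where "B = (b - a) + 1 + \<bar>c\<bar>"
  have "B > 0" using \<open>a \<le> b\<close> by (simp add: B_def)
  have "f b - f a - c * (b - a) \<le> 0 + e" if "e > 0" for e
    using bound[of "e / B"] that \<open>B > 0\<close> by (simp add: B_def)
  then have "f b - f a - c * (b - a) \<le> 0" by (rule field_le_epsilon)
  then show ?thesis by simp
qed

section \<open>Positive vectors of M-matrices\<close>

text \<open>
  Expand each product of the Leibniz formula over the set \<open>S\<close> of rows where the factor comes from
  \<open>C\<close>. The factors from \<open>t I\<close> in the other rows vanish unless the permutation fixes these rows,
  that is, unless it is a permutation of \<open>S\<close>; what is left is the principal minor for \<open>S\<close>.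
\<close>
lemma det_add_scalar_expansion:
  fixes C :: "real^'n^'n"
  shows "det (C + t *\<^sub>R mat 1) = (\<Sum>S\<in>UNIV. t ^ card (- S) * principal_minor C S)"
proof -
  let ?P = "{p. p permutes (UNIV :: 'n set)}"
  have off: "(\<Prod>i\<in>-S. t * (if i = p i then 1 else 0)) = (if p permutes S then t ^ card (- S) else 0)"
    if "p permutes UNIV" for p and S :: "'n set"
  proof (cases "p permutes S")
    case True
    then have "p i = i" if "i \<in> - S" for i using that by (simp add: permutes_not_in)
    then have "(\<Prod>i\<in>-S. t * (if i = p i then 1 else 0)) = (\<Prod>i\<in>-S. t)"
      by (intro prod.cong) auto
    with True show ?thesis by simp
  next
    case False
    then obtain i where "i \<in> - S" "p i \<noteq> i"
      using permutes_superset[of p UNIV S] \<open>p permutes UNIV\<close> by auto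
    then have "\<exists>i\<in>-S. t * (if i = p i then 1 else 0) = 0" by (intro bexI[of _ i]) auto
    with False show ?thesis by (simp only: prod_zero[OF finite] if_False)
  qed
  have "det (C + t *\<^sub>R mat 1)
      = (\<Sum>p\<in>?P. of_int (sign p) * (\<Prod>i\<in>UNIV. C $ i $ p i + t * (if i = p i then 1 else 0)))"
    by (simp add: det_def mat_def)
  also have "\<dots> = (\<Sum>p\<in>?P. \<Sum>S\<in>UNIV. of_int (sign p) * ((\<Prod>i\<in>S. C $ i $ p i) *
      (\<Prod>i\<in>-S. t * (if i = p i then 1 else 0))))"
    by (subst prod_add) (simp_all add: sum_distrib_left Compl_eq_Diff_UNIV)
  also have "\<dots> = (\<Sum>S\<in>UNIV. \<Sum>p\<in>?P. of_int (sign p) * ((\<Prod>i\<in>S. C $ i $ p i) *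
      (\<Prod>i\<in>-S. t * (if i = p i then 1 else 0))))"
    by (rule sum.swap)
  also have "\<dots> = (\<Sum>S\<in>UNIV. t ^ card (- S) * principal_minor C S)"
  proof (rule sum.cong[OF refl])
    fix S :: "'n set"
    have "(\<Sum>p\<in>?P. of_int (sign p) * ((\<Prod>i\<in>S. C $ i $ p i) *
          (\<Prod>i\<in>-S. t * (if i = p i then 1 else 0))))
        = (\<Sum>p\<in>?P. if p permutes S then t ^ card (- S) * (of_int (sign p) * (\<Prod>i\<in>S. C $ i $ p i)) else 0)"
      by (rule sum.cong[OF refl]) (simp add: off)
    also have "\<dots> = (\<Sum>p\<in>{p. p permutes S}. t ^ card (- S) * (of_int (sign p) * (\<Prod>i\<in>S. C $ i $ p i)))"
      by (subst sum.inter_filter[symmetric])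
        (auto intro!: sum.cong permutes_subset[of _ S UNIV] simp: finite_permutations)
    finally show "(\<Sum>p\<in>?P. of_int (sign p) * ((\<Prod>i\<in>S. C $ i $ p i) *
          (\<Prod>i\<in>-S. t * (if i = p i then 1 else 0)))) = t ^ card (- S) * principal_minor C S"
      by (simp add: principal_minor_def sum_distrib_left)
  qed
  finally show ?thesis .
qed

lemma M_matrix_det_add_scalar_pos:
  fixes C :: "real^'n^'n"
  assumes "M_matrix C" "t \<ge> 0"
  shows "det (C + t *\<^sub>R mat 1) > 0"
proof -
  have nonneg: "0 \<le> t ^ card (- S) * principal_minor C S" for S
  proof (cases "S = {}")
    case True
    then show ?thesis using assms(2) by (simp add: principal_minor_def)
  next
    case False
    then show ?thesis using assms by (simp add: M_matrix_def less_imp_le)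
  qed
  have "0 < t ^ card (- UNIV :: 'n set) * principal_minor C UNIV"
    using assms(1) by (simp add: M_matrix_def)
  also have "\<dots> \<le> (\<Sum>S\<in>UNIV. t ^ card (- S) * principal_minor C S)"
    by (rule member_le_sum) (use nonneg in auto)
  finally show ?thesis by (simp add: det_add_scalar_expansion)
qed

text \<open>
  Let \<open>v t\<close> be the solution of \<open>(C + t I) v = 1\<close>, which by Cramer's rule exists and is continuous for
  \<open>t \<ge> 0\<close>. If the least component of \<open>v t\<close> is \<open>m\<close>, then, as the off-diagonal entries are
  nonpositive, the row where it is attained gives \<open>1 \<le> m * (r + t)\<close> with the row sum \<open>r\<close> of \<open>C\<close>. So
  \<open>m\<close> is never \<open>0\<close>, and it is positive for large \<open>t\<close>; by connectedness it is positive down to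
  \<open>t = 0\<close>, and \<open>v 0\<close> is the required vector.
\<close>
lemma M_matrix_obtain_positive_vector:
  fixes C :: "real^'n^'n"
  assumes M: "M_matrix C"
  obtains d :: "real^'n" where "\<And>i. d $ i > 0" "\<And>i. (C *v d) $ i > 0"
proof -
  define B where "B = (\<lambda>t. C + t *\<^sub>R mat 1)"
  define v where "v = (\<lambda>t. \<chi> k. det (\<chi> i j. if j = k then 1 else B t $ i $ j) / det (B t))"
  have det_pos: "det (B t) > 0" if "t \<ge> 0" for t
    using M_matrix_det_add_scalar_pos[OF M that] by (simp add: B_def)
  have row: "(C *v v t) $ i + t * v t $ i = 1" if "t \<ge> 0" for t i
  proof -
    have "B t *v v t = (\<chi> i. 1)"
      using det_pos[OF that] by (subst cramer) (simp_all add: v_def cong: if_cong)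
    then have "(B t *v v t) $ i = 1" by simp
    then show ?thesis
      by (simp add: B_def matrix_vector_mult_add_rdistrib scaleR_matrix_vector_assoc[symmetric])
  qed
  have cont: "continuous_on {0..T} (\<lambda>t. v t $ k)" for k T
  proof -
    have det_cont: "continuous_on {0..T} (\<lambda>t. det (\<chi> i j. E i j t))"
      if "\<And>i j. continuous_on {0..T} (E i j)" for E :: "'n \<Rightarrow> 'n \<Rightarrow> real \<Rightarrow> real"
      unfolding det_def vec_lambda_beta using that by (intro continuous_intros)
    have entry: "continuous_on {0..T} (\<lambda>t. B t $ i $ j)" for i j
      by (auto simp: B_def intro!: continuous_intros)
    then have "continuous_on {0..T} (\<lambda>t. if j = k then 1 else B t $ i $ j)" for i j
      by (cases "j = k") auto
    then show ?thesis
      using det_cont[of "\<lambda>i j t. if j = k then 1 else B t $ i $ j"]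
        det_cont[of "\<lambda>i j t. B t $ i $ j"] entry det_pos
      by (force simp: v_def intro!: continuous_on_divide)
  qed
  have min_row: "1 \<le> m * ((\<Sum>j\<in>UNIV. C $ i $ j) + t)"
    if "t \<ge> 0" "v t $ i = m" "\<And>j. m \<le> v t $ j" for t i m
  proof -
    have "(C *v v t) $ i \<le> (\<Sum>j\<in>UNIV. C $ i $ j * m)"
      unfolding matrix_vector_mult_def vec_lambda_beta
    proof (rule sum_mono)
      fix j show "C $ i $ j * v t $ j \<le> C $ i $ j * m"
        using M that by (cases "i = j") (auto simp: M_matrix_def intro: mult_left_mono_neg)
    qed
    with row[OF that(1), of i] that(2) show ?thesis
      by (simp add: sum_distrib_left sum_distrib_right algebra_simps)
  qed
  \<comment> \<open>The row sums of \<open>C + T I\<close> are nonnegative, which rules out a nonpositive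
    least component.\<close>
  obtain T where "T \<ge> 0" and T: "\<And>i. (\<Sum>j\<in>UNIV. C $ i $ j) + T \<ge> 0"
  proof
    define s where "s = (\<lambda>i. \<Sum>j\<in>UNIV. C $ i $ j)"
    show "(\<Sum>i\<in>UNIV. \<bar>s i\<bar>) \<ge> 0" by (simp add: sum_nonneg)
    fix i
    have "\<bar>s i\<bar> \<le> (\<Sum>i\<in>UNIV. \<bar>s i\<bar>)" by (rule member_le_sum) auto
    then show "(\<Sum>j\<in>UNIV. C $ i $ j) + (\<Sum>i\<in>UNIV. \<bar>s i\<bar>) \<ge> 0" by (simp add: s_def)
  qed
  have argmin: "\<exists>i. \<forall>j. v t $ i \<le> v t $ j" for t
    using arg_min_if_finite(2)[of "UNIV :: 'n set" "\<lambda>i. v t $ i"]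
    by (intro exI[of _ "arg_min_on (\<lambda>i. v t $ i) UNIV"]) (auto simp: not_less)
  define P where "P = {t \<in> {0..T}. \<forall>i. 0 < v t $ i}"
  \<comment> \<open>A nonnegative \<open>v t\<close> has no zero component, so that \<open>P\<close> is
    relatively open and closed.\<close>
  have P_eq: "P = {t \<in> {0..T}. \<forall>i. 0 \<le> v t $ i}"
  proof (rule set_eqI)
    fix t
    show "t \<in> P \<longleftrightarrow> t \<in> {t \<in> {0..T}. \<forall>i. 0 \<le> v t $ i}"
      using min_row[of t _ 0] by (force simp: P_def order_le_less)
  qed
  have "openin (top_of_set {0..T}) P"
  proof -
    have "openin (top_of_set {0..T}) (\<Inter>i. {0..T} \<inter> (\<lambda>t. v t $ i) -` {0<..})"
      by (intro openin_INT2) (auto intro: continuous_openin_preimage_gen[OF cont])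
    also have "(\<Inter>i. {0..T} \<inter> (\<lambda>t. v t $ i) -` {0<..}) = P" by (auto simp: P_def)
    finally show ?thesis .
  qed
  moreover have "closedin (top_of_set {0..T}) P"
  proof -
    have "closedin (top_of_set {0..T}) (\<Inter>i. {0..T} \<inter> (\<lambda>t. v t $ i) -` {0..})"
      by (intro closedin_INT) (auto intro: continuous_closedin_preimage[OF cont])
    also have "(\<Inter>i. {0..T} \<inter> (\<lambda>t. v t $ i) -` {0..}) = P" by (auto simp: P_eq)
    finally show ?thesis .
  qed
  moreover have "T \<in> P"
  proof -
    obtain i where i: "\<And>j. v T $ i \<le> v T $ j" using argmin by blast
    have "v T $ i > 0"
    proof (rule ccontr)
      assume "\<not> v T $ i > 0"
      with T[of i] have "v T $ i * ((\<Sum>j\<in>UNIV. C $ i $ j) + T) \<le> 0"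
        by (intro mult_nonpos_nonneg) auto
      with min_row[OF \<open>T \<ge> 0\<close> refl i] show False by linarith
    qed
    with i \<open>T \<ge> 0\<close> show ?thesis by (auto simp: P_def intro: less_le_trans)
  qed
  ultimately have "P = {0..T}"
    using connected_clopen[of "{0..T}"] by auto
  with \<open>T \<ge> 0\<close> have "0 \<in> P" by simp
  with row[of 0] that[of "v 0"] show thesis by (simp add: P_def)
qed

section \<open>Comparison with an exponential barrier\<close>

text \<open>
  The comparison argument. The hypothesis \<open>rate\<close> says that the barrier
  \<open>D i * W t = K * P * d i * exp (- \<gamma> * (t - t0))\<close> decays more slowly than the equation forces a
  component that touches it to decay; the term \<open>2 * A i * exp (\<gamma> * s)\<close> pays for the oscillation of the
  initial function, which is not controlled by any derivative.

  Suppose that the barrier is reached, and let \<open>T\<close> be the first time and \<open>k\<close> a component where this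
  happens. Before \<open>T\<close> all components lie below the barrier, so the right-hand side is bounded; hence
  replacing \<open>X (h k u) $ k\<close> by \<open>X u $ k\<close> costs a controlled error. Let \<open>y\<close> be this component times
  its sign at \<open>T\<close>; while \<open>y\<close> is positive, it satisfies \<open>y' \<le> - \<alpha> k * y + q * W\<close> almost everywhere,
  with \<open>q < (\<alpha> k - \<gamma>) * D k\<close>. Just before \<open>T\<close> the slope of \<open>y\<close> is then less
  than that of the barrier, and \<open>y\<close> would have been above the barrier before \<open>T\<close>.
\<close>
lemma solution_decay:
  fixes \<alpha> A \<tau> d :: "'n::finite \<Rightarrow> real"
    and \<sigma> L :: "'n \<Rightarrow> 'n \<Rightarrow> real"
    and X :: "real \<Rightarrow> real^'n"
  assumes pos: "\<And>i. 0 < \<alpha> i" "\<And>i j. 0 \<le> L i j"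
    and a_bounds: "\<And>i t. 0 \<le> t \<Longrightarrow> \<alpha> i \<le> a i t \<and> a i t \<le> A i"
    and F_bound: "\<And>i j t u. 0 \<le> t \<Longrightarrow> \<bar>F i j t u\<bar> \<le> L i j * \<bar>u\<bar>"
    and h_delay: "\<And>i t. 0 \<le> t \<Longrightarrow> 0 \<le> t - h i t \<and> t - h i t \<le> \<tau> i"
    and g_delay: "\<And>i j t. 0 \<le> t \<Longrightarrow> 0 \<le> t - g i j t \<and> t - g i j t \<le> \<sigma> i j"
    and delay_le: "\<And>i. \<tau> i \<le> s" "\<And>i j. \<sigma> i j \<le> s"
    and d_pos: "\<And>i. 0 < d i" and "0 < \<gamma>"
    and history_dominated: "\<And>i. 1 < K * d i"
    and rate: "\<And>i. K * exp (2 * \<gamma> * s) *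
        (A i * \<tau> i * (A i * d i + (\<Sum>j\<in>UNIV. L i j * d j)) + (\<Sum>j\<in>UNIV. L i j * d j))
        + 2 * A i * exp (\<gamma> * s) < K * (\<alpha> i - \<gamma>) * d i"
    and sol: "is_solution a h F g s t0 \<phi> X" and "0 \<le> t0"
    and "0 < P" and history: "\<And>u i. t0 - s \<le> u \<Longrightarrow> u \<le> t0 \<Longrightarrow> \<bar>X u $ i\<bar> \<le> P"
    and "t0 \<le> t"
  shows "\<bar>X t $ i\<bar> < K * P * d i * exp (- \<gamma> * (t - t0))"
proof -
  define W where "W = (\<lambda>u. exp (- \<gamma> * (u - t0)))"
  define E where "E = exp (\<gamma> * s)"
  define D where "D = (\<lambda>i. K * P * d i)"
  define R where "R = (\<lambda>i. A i * D i + (\<Sum>j\<in>UNIV. L i j * D j))"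
  have W_pos: "0 < W u" for u by (simp add: W_def)
  have W_anti: "W v \<le> W u" if "u \<le> v" for u v using that \<open>0 < \<gamma>\<close> by (simp add: W_def)
  have W_lag: "W u \<le> W v * E" if "v - s \<le> u" for u v
  proof -
    have "\<gamma> * (v - s) \<le> \<gamma> * u" using that \<open>0 < \<gamma>\<close> by (intro mult_left_mono) auto
    then show ?thesis unfolding W_def E_def exp_add[symmetric] by (simp add: algebra_simps)
  qed
  have A_nonneg: "0 < A i" for i using a_bounds[of 0 i] pos(1)[of i] by linarith
  have tau_nonneg: "0 \<le> \<tau> i" for i using h_delay[of 0 i] by linarith
  then have "0 \<le> s" using delay_le(1) order_trans by blast
  then have "1 \<le> E" using \<open>0 < \<gamma>\<close> by (simp add: E_def)
  have "0 < K" using history_dominated[of undefined] d_pos[of undefined]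
    by (metis less_trans zero_less_mult_pos2 zero_less_one)
  then have D_pos: "0 < D i" for i using \<open>0 < P\<close> d_pos by (simp add: D_def)
  have P_less: "P < D i" for i
    using history_dominated[of i] \<open>0 < P\<close> by (simp add: D_def algebra_simps)
  have R_nonneg: "0 \<le> R i" for i unfolding R_def
    using pos(2) A_nonneg D_pos by (intro add_nonneg_nonneg sum_nonneg mult_nonneg_nonneg) (auto simp: less_imp_le)

  from sol obtain Z where "negligible Z"
    and deriv: "\<And>u. t0 < u \<Longrightarrow> u \<notin> Z \<Longrightarrow> (X has_vector_derivative delay_rhs a h F g X u) (at u)"
    by (auto simp: is_solution_def AE_restrict_space_iff eventually_ae_filter_negligible)
  have ac: "absolutely_continuous_on {b..c} X" if "t0 \<le> b" for b c
    using sol that by (auto simp: is_solution_def locally_absolutely_continuous_on_def)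
  \<comment> \<open>Both signs \<open>\<epsilon> = 1\<close> and \<open>\<epsilon> = -1\<close> are needed:
    for two-sided bounds and for the sign of the touching component.\<close>
  have increment: "\<epsilon> * X c $ i - \<epsilon> * X b $ i \<le> m * (c - b)"
    if "t0 \<le> b" "b \<le> c"
      "\<And>u. b < u \<Longrightarrow> u < c \<Longrightarrow> \<epsilon> * delay_rhs a h F g X u $ i \<le> m" for \<epsilon> b c i m
  proof -
    have lin: "bounded_linear (\<lambda>x :: real^'n. \<epsilon> * x $ i)"
      by (intro bounded_linear_const_mult bounded_linear_vec_nth)
    show ?thesis
    proof (rule absolutely_continuous_on_deriv_le_imp_increment_le[OF that(2) _ \<open>negligible Z\<close>])
      show "absolutely_continuous_on {b..c} (\<lambda>u. \<epsilon> * X u $ i)"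
        by (rule absolutely_continuous_on_linear_image[OF ac[OF that(1)] lin])
      fix u assume u: "b < u" "u < c" "u \<notin> Z"
      then have "((\<lambda>u. \<epsilon> * X u $ i) has_real_derivative \<epsilon> * delay_rhs a h F g X u $ i) (at u)"
        using bounded_linear.has_vector_derivative[OF lin deriv[of u]] that(1)
        by (simp add: has_real_derivative_iff_has_vector_derivative)
      then show "\<exists>D\<le>m. ((\<lambda>u. \<epsilon> * X u $ i) has_real_derivative D) (at u)"
        using that(3) u by blast
    qed
  qed
  have cont: "continuous_on {t0..b} X" for b
    by (intro absolutely_continuous_on_imp_continuous_on ac) simp
  have contW: "continuous_on S W" for S unfolding W_def by (intro continuous_intros)

  have "\<bar>X t $ i\<bar> < D i * W t" if "t0 \<le> t" for t i
  proof (rule ccontr)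
    assume bad_t: "\<not> \<bar>X t $ i\<bar> < D i * W t"
    define bad where "bad = (\<Union>i. {u \<in> {t0..t}. D i * W u \<le> \<bar>X u $ i\<bar>})"
    have "closed bad" unfolding bad_def
      by (intro closed_UN finite ballI continuous_on_closed_Collect_le continuous_intros contW cont)
    moreover have "bad \<subseteq> {t0..t}" by (auto simp: bad_def)
    ultimately have "compact bad"
      using compact_Int_closed[of "{t0..t}" bad] by (simp add: Int_absorb1)
    moreover have "t \<in> bad" using bad_t that by (auto simp: bad_def not_less)
    ultimately obtain T where "T \<in> bad" and T_least: "\<And>u. u \<in> bad \<Longrightarrow> T \<le> u"
      using compact_attains_inf[of bad] by blast
    then obtain k where k: "D k * W T \<le> \<bar>X T $ k\<bar>" and "t0 \<le> T" "T \<le> t" by (auto simp: bad_def)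

    have before: "\<bar>X u $ j\<bar> < D j * W u" if "t0 - s \<le> u" "u < T" for u j
    proof (cases "u \<le> t0")
      case True
      then have "1 \<le> W u" using \<open>0 < \<gamma>\<close> by (simp add: W_def mult_nonneg_nonpos)
      then have "D j * 1 \<le> D j * W u" using D_pos by (intro mult_left_mono) (auto simp: less_imp_le)
      with history[OF that(1) True, of j] P_less[of j] show ?thesis by linarith
    next
      case False
      then show ?thesis using T_least[of u] that \<open>T \<le> t\<close> by (force simp: bad_def not_less)
    qed
    have "t0 \<noteq> T"
    proof
      assume "t0 = T"
      then have "\<bar>X T $ k\<bar> \<le> P" using history[of t0 k] \<open>0 \<le> s\<close> by simp
      with k P_less[of k] \<open>t0 = T\<close> show False by (simp add: W_def)
    qed
    with \<open>t0 \<le> T\<close> have "t0 < T" by simp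
    have delayed: "\<bar>X v $ j\<bar> \<le> D j * (W u * E)" if "t0 \<le> u" "u < T" "u - s \<le> v" "v \<le> u" for u v j
    proof -
      have "\<bar>X v $ j\<bar> < D j * W v" using before[of v j] that by linarith
      also have "\<dots> \<le> D j * (W u * E)"
        using W_lag[OF that(3)] D_pos by (intro mult_left_mono) (auto simp: less_imp_le)
      finally show ?thesis by simp
    qed
    have F_le: "\<bar>\<Sum>j\<in>UNIV. F i j u (X (g i j u) $ j)\<bar> \<le> W u * E * (\<Sum>j\<in>UNIV. L i j * D j)"
      if "t0 \<le> u" "u < T" for u i
    proof -
      have "\<bar>F i j u (X (g i j u) $ j)\<bar> \<le> W u * E * (L i j * D j)" for j
      proof -
        have "\<bar>X (g i j u) $ j\<bar> \<le> D j * (W u * E)"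
          using g_delay[of u i j] delay_le(2)[of i j] that \<open>0 \<le> t0\<close> by (intro delayed) auto
        then have "L i j * \<bar>X (g i j u) $ j\<bar> \<le> L i j * (D j * (W u * E))"
          using pos(2) by (intro mult_left_mono) auto
        with F_bound[of u i j "X (g i j u) $ j"] that \<open>0 \<le> t0\<close> show ?thesis by (simp add: algebra_simps)
      qed
      then have "(\<Sum>j\<in>UNIV. \<bar>F i j u (X (g i j u) $ j)\<bar>) \<le> W u * E * (\<Sum>j\<in>UNIV. L i j * D j)"
        unfolding sum_distrib_left by (intro sum_mono)
      then show ?thesis by (rule order_trans[OF sum_abs])
    qed
    have rhs_le: "\<bar>delay_rhs a h F g X u $ i\<bar> \<le> W u * E * R i" if "t0 \<le> u" "u < T" for u i
    proof -
      have "\<bar>X (h i u) $ i\<bar> \<le> D i * (W u * E)"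
        using h_delay[of u i] delay_le(1)[of i] that \<open>0 \<le> t0\<close> by (intro delayed) auto
      moreover have "\<bar>a i u\<bar> \<le> A i" using a_bounds[of u i] pos(1)[of i] that \<open>0 \<le> t0\<close> by linarith
      ultimately have "\<bar>a i u * X (h i u) $ i\<bar> \<le> A i * (D i * (W u * E))"
        unfolding abs_mult by (intro mult_mono) auto
      with F_le[OF that, of i] show ?thesis by (simp add: delay_rhs_def R_def algebra_simps)
    qed
    have lag: "\<bar>X u $ i - X (h i u) $ i\<bar> \<le> W u * (E * E * R i * \<tau> i + 2 * P * E)"
      if "t0 \<le> u" "u < T" for u i
    proof -
      have "0 \<le> u" using that \<open>0 \<le> t0\<close> by simp
      \<comment> \<open>The equation holds only after \<open>t0\<close>; on the part of the delay interval
        before \<open>t0\<close> only the bound \<open>P\<close> on the initial function is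
        available.\<close>
      define c where "c = max (h i u) t0"
      have c: "t0 \<le> c" "c \<le> u" "u - c \<le> \<tau> i"
        using h_delay[OF \<open>0 \<le> u\<close>, of i] that by (auto simp: c_def)
      define m where "m = W u * E * E * R i"
      have "0 \<le> m" using W_pos[of u] R_nonneg[of i] by (simp add: m_def E_def)
      have rhs_m: "\<bar>delay_rhs a h F g X v $ i\<bar> \<le> m" if "c < v" "v < u" for v
      proof -
        have "W v * (E * R i) \<le> (W u * E) * (E * R i)"
          using W_lag[of u v] c delay_le(1)[of i] that R_nonneg[of i] \<open>1 \<le> E\<close>
          by (intro mult_right_mono) auto
        with rhs_le[of v i] c that \<open>u < T\<close> show ?thesis by (simp add: m_def algebra_simps)
      qed
      have "X u $ i - X c $ i \<le> m * (u - c)" "X c $ i - X u $ i \<le> m * (u - c)"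
        using increment[of c u 1 i m] increment[of c u "-1" i m] c rhs_m by (auto simp: abs_le_iff)
      moreover have "m * (u - c) \<le> m * \<tau> i" using c(3) \<open>0 \<le> m\<close> by (rule mult_left_mono)
      ultimately have "\<bar>X u $ i - X c $ i\<bar> \<le> m * \<tau> i" by linarith
      moreover have "\<bar>X c $ i - X (h i u) $ i\<bar> \<le> W u * (2 * P * E)"
      proof (cases "h i u < t0")
        case True
        then have "c = t0" "t0 - s \<le> h i u" "u - s \<le> t0"
          using h_delay[OF \<open>0 \<le> u\<close>, of i] delay_le(1)[of i] that by (auto simp: c_def)
        with True history[of t0 i] history[of "h i u" i] \<open>0 \<le> s\<close>
        have "\<bar>X c $ i - X (h i u) $ i\<bar> \<le> 1 * (2 * P)" by simp
        also have "1 * (2 * P) \<le> (W u * E) * (2 * P)"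
          using W_lag[OF \<open>u - s \<le> t0\<close>] \<open>0 < P\<close> by (intro mult_right_mono) (auto simp: W_def)
        finally show ?thesis by (simp add: algebra_simps)
      next
        case False
        then show ?thesis using W_pos[of u] \<open>0 < P\<close> \<open>1 \<le> E\<close> by (simp add: c_def)
      qed
      ultimately show ?thesis by (simp add: m_def algebra_simps)
    qed
    define q where "q = A k * (E * E * R k * \<tau> k + 2 * P * E) + E * (\<Sum>j\<in>UNIV. L k j * D j)"
    have q_less: "q < (\<alpha> k - \<gamma>) * D k"
    proof -
      define S where "S = (\<Sum>j\<in>UNIV. L k j * d j)"
      have S_D: "(\<Sum>j\<in>UNIV. L k j * D j) = K * P * S"
        by (simp add: S_def D_def sum_distrib_left algebra_simps)
      have "0 \<le> S" using pos(2) d_pos by (auto simp: S_def less_imp_le intro!: sum_nonneg)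
      have EE: "exp (2 * \<gamma> * s) = E * E" by (simp add: E_def exp_add[symmetric])
      have "E * 1 * (K * P * S) \<le> E * E * (K * P * S)"
        using \<open>1 \<le> E\<close> \<open>0 < K\<close> \<open>0 < P\<close> \<open>0 \<le> S\<close> by (intro mult_right_mono mult_left_mono) auto
      then have "q \<le> P * (K * (E * E) * (A k * \<tau> k * (A k * d k + S) + S) + 2 * A k * E)"
        unfolding q_def R_def S_D by (simp add: D_def algebra_simps)
      also have "\<dots> < P * (K * (\<alpha> k - \<gamma>) * d k)"
        using rate[of k] \<open>0 < P\<close> unfolding EE S_def[symmetric] E_def[symmetric]
        by (intro mult_strict_left_mono) auto
      finally show ?thesis by (simp add: D_def algebra_simps)
    qed
    define \<epsilon> where "\<epsilon> = sgn (X T $ k)"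
    have "0 < D k * W T" using D_pos W_pos by simp
    with k have "X T $ k \<noteq> 0" by auto
    then have \<epsilon>: "\<epsilon> = 1 \<or> \<epsilon> = -1" by (auto simp: \<epsilon>_def sgn_if)
    define y where "y = (\<lambda>u. \<epsilon> * X u $ k)"
    have y_T: "D k * W T \<le> y T" using k by (simp add: y_def \<epsilon>_def sgn_mult_self_eq abs_sgn mult.commute)
    have y_rhs: "\<epsilon> * delay_rhs a h F g X u $ k \<le> - \<alpha> k * y u + W u * q"
      if "t0 \<le> u" "u < T" "0 < y u" for u
    proof -
      define l where "l = \<epsilon> * (X u $ k - X (h k u) $ k)"
      define f where "f = (\<Sum>j\<in>UNIV. F k j u (X (g k j u) $ j))"
      have au: "\<alpha> k \<le> a k u" "a k u \<le> A k" using a_bounds[of u k] that \<open>0 \<le> t0\<close> by auto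
      have "a k u * l \<le> \<bar>a k u\<bar> * \<bar>l\<bar>" by (metis abs_ge_self abs_mult)
      also have "\<bar>l\<bar> = \<bar>X u $ k - X (h k u) $ k\<bar>" using \<epsilon> by (auto simp: l_def)
      also have "\<bar>a k u\<bar> * \<bar>X u $ k - X (h k u) $ k\<bar> \<le> A k * (W u * (E * E * R k * \<tau> k + 2 * P * E))"
        using lag[OF that(1,2), of k] au pos(1)[of k] by (intro mult_mono) auto
      finally have l: "a k u * l \<le> A k * (W u * (E * E * R k * \<tau> k + 2 * P * E))" .
      have "\<epsilon> * f \<le> \<bar>f\<bar>" using \<epsilon> by auto
      with F_le[OF that(1,2), of k] have f: "\<epsilon> * f \<le> W u * E * (\<Sum>j\<in>UNIV. L k j * D j)"
        by (simp add: f_def)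
      have "\<alpha> k * y u \<le> a k u * y u" using au that(3) by (intro mult_right_mono) auto
      moreover have "\<epsilon> * delay_rhs a h F g X u $ k = - (a k u * y u) + a k u * l + \<epsilon> * f"
        by (simp add: delay_rhs_def y_def l_def f_def algebra_simps)
      ultimately show ?thesis using l f by (simp add: q_def algebra_simps)
    qed
    have "- \<alpha> k * y T + W T * q < - \<gamma> * (D k * W T)"
    proof -
      have "\<alpha> k * (D k * W T) \<le> \<alpha> k * y T" using y_T pos(1)[of k] by (intro mult_left_mono) auto
      moreover have "W T * q < W T * ((\<alpha> k - \<gamma>) * D k)"
        using q_less W_pos by (intro mult_strict_left_mono) auto
      ultimately show ?thesis by (simp add: algebra_simps)
    qed
    \<comment> \<open>A constant slope \<open>c\<close> strictly between the slope bound for \<open>y\<close>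
      and the slope of the barrier at \<open>T\<close> separates the two on a left
      neighbourhood of \<open>T\<close>.\<close>
    then obtain c where c: "- \<alpha> k * y T + W T * q < c" "c < - \<gamma> * (D k * W T)"
      using dense by blast
    have y_lim: "(y \<longlongrightarrow> y T) (at_left T)"
    proof -
      have "continuous_on {t0..T} y" unfolding y_def by (intro continuous_intros cont)
      then have "(y \<longlongrightarrow> y T) (at T within {t0..T})"
        using \<open>t0 < T\<close> by (auto simp: continuous_on_def)
      then show ?thesis using \<open>t0 < T\<close> by (simp add: at_within_Icc_at_left)
    qed
    have W_lim: "(W \<longlongrightarrow> W T) (at_left T)"
      unfolding W_def by (intro tendsto_intros)
    have "\<forall>\<^sub>F u in at_left T. - \<alpha> k * y u + W u * q < c"
      by (rule order_tendstoD(2)[OF _ c(1)]) (intro tendsto_intros y_lim W_lim)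
    moreover have "\<forall>\<^sub>F u in at_left T. c < - \<gamma> * (D k * W u)"
      by (rule order_tendstoD(1)[OF _ c(2)]) (intro tendsto_intros W_lim)
    moreover have "\<forall>\<^sub>F u in at_left T. 0 < y u"
      using order_tendstoD(1)[OF y_lim, of 0] y_T \<open>0 < D k * W T\<close> by linarith
    ultimately have "\<forall>\<^sub>F u in at_left T. - \<alpha> k * y u + W u * q < c \<and> c < - \<gamma> * (D k * W u) \<and> 0 < y u"
      by eventually_elim blast
    then obtain b where "b < T" and b: "\<And>u. b < u \<Longrightarrow> u < T \<Longrightarrow>
        - \<alpha> k * y u + W u * q < c \<and> c < - \<gamma> * (D k * W u) \<and> 0 < y u"
      unfolding eventually_at_left_field by blast
    define t1 where "t1 = (max b t0 + T) / 2"
    have t1: "t0 < t1" "b < t1" "t1 < T" using \<open>b < T\<close> \<open>t0 < T\<close> by (auto simp: t1_def)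
    have "y T - y t1 \<le> c * (T - t1)"
      unfolding y_def
    proof (rule increment)
      fix u assume "t1 < u" "u < T"
      with y_rhs[of u] b[of u] t1 show "\<epsilon> * delay_rhs a h F g X u $ k \<le> c" by force
    qed (use t1 in auto)
    moreover have "y t1 < D k * W t1"
      using before[of t1 k] t1 \<epsilon> \<open>0 \<le> s\<close> by (auto simp: y_def)
    \<comment> \<open>The barrier is convex, so it lies above its tangent at \<open>t1\<close>.\<close>
    moreover have "D k * W t1 - \<gamma> * (D k * W t1) * (T - t1) \<le> D k * W T"
    proof -
      have "W T = W t1 * exp (- \<gamma> * (T - t1))"
        unfolding W_def exp_add[symmetric] by (simp add: algebra_simps)
      moreover have "1 + - \<gamma> * (T - t1) \<le> exp (- \<gamma> * (T - t1))" by (rule exp_ge_add_one_self)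
      then have "D k * W t1 * (1 + - \<gamma> * (T - t1)) \<le> D k * W t1 * exp (- \<gamma> * (T - t1))"
        using D_pos W_pos by (intro mult_left_mono) (auto simp: less_imp_le)
      ultimately show ?thesis by (simp add: algebra_simps)
    qed
    moreover have "c * (T - t1) < - \<gamma> * (D k * W t1) * (T - t1)"
      using b[OF t1(2,3)] t1(3) by (intro mult_strict_right_mono) auto
    ultimately show False using y_T by linarith
  qed
  then show ?thesis using \<open>t0 \<le> t\<close> by (simp add: D_def W_def)
qed

section \<open>Equivalence of norms\<close>

lemma is_norm_zero_iff: "is_norm N \<Longrightarrow> N x = 0 \<longleftrightarrow> x = 0"
  and is_norm_scaleR: "is_norm N \<Longrightarrow> N (c *\<^sub>R x) = \<bar>c\<bar> * N x"
  and is_norm_triangle: "is_norm N \<Longrightarrow> N (x + y) \<le> N x + N y"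
  unfolding is_norm_def by blast+

lemma is_norm_triangle_sum:
  assumes "is_norm N" "finite I"
  shows "N (\<Sum>i\<in>I. f i) \<le> (\<Sum>i\<in>I. N (f i))"
  using assms(2)
proof (induction I rule: finite_induct)
  case empty
  then show ?case using is_norm_zero_iff[OF assms(1), of 0] by simp
next
  case (insert i I)
  then show ?case using is_norm_triangle[OF assms(1), of "f i" "sum f I"] by simp
qed

lemma is_norm_le_sum_components:
  fixes N :: "real^'n \<Rightarrow> real"
  assumes "is_norm N"
  shows "N x \<le> (\<Sum>i\<in>UNIV. \<bar>x $ i\<bar> * N (axis i 1))"
proof -
  have "N x = N (\<Sum>i\<in>UNIV. x $ i *\<^sub>R axis i 1)"
    using basis_expansion[of x] by (simp add: scalar_mult_eq_scaleR)
  also have "\<dots> \<le> (\<Sum>i\<in>UNIV. N (x $ i *\<^sub>R axis i 1))"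
    by (rule is_norm_triangle_sum[OF assms finite])
  also have "\<dots> = (\<Sum>i\<in>UNIV. \<bar>x $ i\<bar> * N (axis i 1))"
    by (simp add: is_norm_scaleR[OF assms])
  finally show ?thesis .
qed

lemma is_norm_nonneg:
  assumes "is_norm N"
  shows "0 \<le> N x"
proof -
  have "N (- x) = N x" using is_norm_scaleR[OF assms, of "-1" x] by simp
  moreover have "N 0 = 0" by (simp add: is_norm_zero_iff[OF assms])
  ultimately show ?thesis using is_norm_triangle[OF assms, of x "- x"] by simp
qed

lemma is_norm_continuous_on:
  fixes N :: "real^'n \<Rightarrow> real"
  assumes N: "is_norm N"
  shows "continuous_on S N"
proof -
  define B where "B = (\<Sum>i\<in>UNIV. N (axis i (1::real) :: real^'n))"
  have upper: "N x \<le> norm x * B" for x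
  proof -
    have "N x \<le> (\<Sum>i\<in>UNIV. \<bar>x $ i\<bar> * N (axis i 1))" by (rule is_norm_le_sum_components[OF N])
    also have "\<dots> \<le> (\<Sum>i\<in>UNIV. norm x * N (axis i 1))"
      by (intro sum_mono mult_right_mono component_le_norm_cart is_norm_nonneg[OF N])
    finally show ?thesis by (simp add: B_def sum_distrib_left)
  qed
  have diff: "N x - N y \<le> N (x - y)" for x y
    using is_norm_triangle[OF N, of "x - y" y] by simp
  have "0 \<le> B" by (simp add: B_def sum_nonneg is_norm_nonneg[OF N])
  have "B-lipschitz_on S N"
  proof (rule lipschitz_onI[OF _ \<open>0 \<le> B\<close>])
    fix x y
    have "N x - N y \<le> norm (x - y) * B" "N y - N x \<le> norm (x - y) * B"
      using diff[of x y] diff[of y x] upper[of "x - y"] upper[of "y - x"]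
      by (auto simp: norm_minus_commute)
    then show "dist (N x) (N y) \<le> B * dist x y"
      by (simp add: dist_real_def dist_norm mult.commute)
  qed
  then show ?thesis by (rule lipschitz_on_continuous_on)
qed

text \<open>
  The equivalence of norms in finite dimension: \<open>N\<close> is continuous and has no zero on the Euclidean
  unit sphere, so by compactness it has a positive minimum there.
\<close>
lemma is_norm_dominates_components:
  fixes N :: "real^'n \<Rightarrow> real"
  assumes N: "is_norm N"
  obtains B where "B > 0" "\<And>x i. \<bar>x $ i\<bar> \<le> B * N x"
proof -
  have "sphere 0 1 \<noteq> ({} :: (real^'n) set)" using vector_choose_size[of 1] by force
  then obtain z :: "real^'n" where z: "z \<in> sphere 0 1" "\<And>x. x \<in> sphere 0 1 \<Longrightarrow> N z \<le> N x"
    using continuous_attains_inf[OF compact_sphere _ is_norm_continuous_on[OF N]] by blast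
  have "N z \<noteq> 0" using z(1) by (auto simp: is_norm_zero_iff[OF N])
  then have "0 < N z" using is_norm_nonneg[OF N, of z] by simp
  have lower: "norm x * N z \<le> N x" for x
  proof (cases "x = 0")
    case True
    then show ?thesis using is_norm_nonneg[OF N] by simp
  next
    case False
    have "N x = N (norm x *\<^sub>R ((1 / norm x) *\<^sub>R x))" using False by simp
    also have "\<dots> = norm x * N ((1 / norm x) *\<^sub>R x)" unfolding is_norm_scaleR[OF N] by simp
    finally show ?thesis using z(2)[of "(1 / norm x) *\<^sub>R x"] False by (simp add: mult_left_mono)
  qed
  have "\<bar>x $ i\<bar> \<le> (1 / N z) * N x" for x i
  proof -
    have "\<bar>x $ i\<bar> * N z \<le> norm x * N z"
      using \<open>0 < N z\<close> by (intro mult_right_mono component_le_norm_cart) simp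
    also have "\<dots> \<le> N x" by (rule lower)
    finally show ?thesis using \<open>0 < N z\<close> by (simp add: field_simps)
  qed
  with \<open>0 < N z\<close> show thesis by (intro that[of "1 / N z"]) auto
qed


section \<open>Exponential stability\<close>

text \<open>
  Since there are only finitely many strict inequalities at \<open>\<gamma> = 0\<close>, they survive a small positive
  \<open>\<gamma>\<close>.
\<close>
lemma obtain_decay_rate:
  fixes \<alpha> \<rho> d :: "'n::finite \<Rightarrow> real"
  assumes "\<And>i. \<rho> i < \<alpha> i * d i"
  obtains \<gamma> where "\<gamma> > 0" "\<And>i. exp (2 * \<gamma> * s) * \<rho> i < (\<alpha> i - \<gamma>) * d i"
proof -
  have "\<forall>\<^sub>F \<gamma> in at_right 0. exp (2 * \<gamma> * s) * \<rho> i < (\<alpha> i - \<gamma>) * d i" for i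
  proof -
    have "((\<lambda>\<gamma>. (\<alpha> i - \<gamma>) * d i - exp (2 * \<gamma> * s) * \<rho> i) \<longlongrightarrow> (\<alpha> i - 0) * d i - exp (2 * 0 * s) * \<rho> i)
        (at_right 0)"
      by (intro tendsto_intros)
    from order_tendstoD(1)[OF this, of 0] assms[of i] show ?thesis by simp
  qed
  then have "\<forall>\<^sub>F \<gamma> in at_right (0::real). \<gamma> > 0 \<and> (\<forall>i. exp (2 * \<gamma> * s) * \<rho> i < (\<alpha> i - \<gamma>) * d i)"
    by (intro eventually_conj eventually_at_right_less eventually_all_finite)
  then obtain \<gamma> where "\<gamma> > 0 \<and> (\<forall>i. exp (2 * \<gamma> * s) * \<rho> i < (\<alpha> i - \<gamma>) * d i)"
    using eventually_happens' trivial_limit_at_right_real by blast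
  with that show thesis by blast
qed

text \<open>
  This is how the matrix enters: the subtracted term bounds, for a solution with
  \<open>\<bar>X $ j\<bar> \<le> d $ j\<close>, the perturbation of \<open>x' = - a x\<close> in the \<open>i\<close>-th equation. Its first part
  \<open>A i * \<tau> i * (\<dots>)\<close> comes from the lag of \<open>h i\<close>, as the bracket bounds the derivative of the \<open>i\<close>-th
  component; its second part comes from the \<open>F i j\<close>.
\<close>
lemma stability_matrix_row:
  assumes "0 < \<alpha> i"
  shows "\<alpha> i * (stability_matrix \<alpha> A \<tau> L *v d) $ i =
    \<alpha> i * d $ i - (A i * \<tau> i * (A i * d $ i + (\<Sum>j\<in>UNIV. L i j * d $ j)) + (\<Sum>j\<in>UNIV. L i j * d $ j))"
proof -
  have entry: "\<alpha> i * (stability_matrix \<alpha> A \<tau> L $ i $ j * d $ j) =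
      (if j = i then (\<alpha> i - A i * A i * \<tau> i) * d $ j else 0) - (A i * \<tau> i + 1) * (L i j * d $ j)" for j
    using assms by (auto simp: stability_matrix_def field_simps)
  have "\<alpha> i * (stability_matrix \<alpha> A \<tau> L *v d) $ i =
      (\<Sum>j\<in>UNIV. \<alpha> i * (stability_matrix \<alpha> A \<tau> L $ i $ j * d $ j))"
    by (simp add: matrix_vector_mult_def sum_distrib_left)
  also have "\<dots> = (\<alpha> i - A i * A i * \<tau> i) * d $ i - (A i * \<tau> i + 1) * (\<Sum>j\<in>UNIV. L i j * d $ j)"
    unfolding entry sum_subtractf sum_distrib_left by simp
  finally show ?thesis by (simp add: algebra_simps)
qed

lemma le_sup_on:
  assumes "bdd_above (f ` S)" "t \<in> S"
  shows "f t \<le> sup_on S f"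
  using assms by (auto simp: sup_on_def intro: cSUP_upper)

lemma max_delay_ge: "\<tau> i \<le> max_delay \<tau> \<sigma>" "\<sigma> i j \<le> max_delay \<tau> \<sigma>"
proof -
  have "{\<sigma> i j | i j. True} = (\<lambda>(i, j). \<sigma> i j) ` UNIV" by auto
  then have "finite (range \<tau> \<union> {\<sigma> i j | i j. True})" by simp
  then show "\<tau> i \<le> max_delay \<tau> \<sigma>" "\<sigma> i j \<le> max_delay \<tau> \<sigma>"
    unfolding max_delay_def by (auto intro!: Max_ge)
qed

theorem theorem2p4:
  fixes \<alpha> A \<tau> :: "'n::finite \<Rightarrow> real"
    and \<sigma> L :: "'n \<Rightarrow> 'n \<Rightarrow> real"
    and a h :: "'n \<Rightarrow> real \<Rightarrow> real"
    and g :: "'n \<Rightarrow> 'n \<Rightarrow> real \<Rightarrow> real"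
    and F :: "'n \<Rightarrow> 'n \<Rightarrow> real \<Rightarrow> real \<Rightarrow> real"
    and N :: "real^'n \<Rightarrow> real"
  assumes norm: "is_norm N"
    and constants: "\<And>i. 0 < \<alpha> i" "\<And>i. \<alpha> i \<le> A i" "\<And>i. 0 \<le> \<tau> i"
      "\<And>i j. 0 \<le> \<sigma> i j" "\<And>i j. 0 \<le> L i j"
    and a_meas: "\<And>i. a i \<in> borel_measurable (lebesgue_on {0..})"
    and a_ess: "\<And>i. essentially_bounded_on {0..} (a i)"
    and a_bounds: "\<And>i t. 0 \<le> t \<Longrightarrow> \<alpha> i \<le> a i t \<and> a i t \<le> A i"
    and F_cont: "\<And>i j t. 0 \<le> t \<Longrightarrow> continuous_on UNIV (F i j t)"
    and F_meas: "\<And>i j u. (\<lambda>t. F i j t u) \<in> borel_measurable (lebesgue_on {0..})"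
    and F_ess: "\<And>i j u. locally_essentially_bounded_on {0..} (\<lambda>t. F i j t u)"
    and F_bound: "\<And>i j t u. 0 \<le> t \<Longrightarrow> \<bar>F i j t u\<bar> \<le> L i j * \<bar>u\<bar>"
    and h_meas: "\<And>i. h i \<in> borel_measurable (lebesgue_on {0..})"
    and h_delay: "\<And>i t. 0 \<le> t \<Longrightarrow> 0 \<le> t - h i t \<and> t - h i t \<le> \<tau> i"
    and g_meas: "\<And>i j. g i j \<in> borel_measurable (lebesgue_on {0..})"
    and g_delay: "\<And>i j t. 0 \<le> t \<Longrightarrow> 0 \<le> t - g i j t \<and> t - g i j t \<le> \<sigma> i j"
    and wellposed: "uniquely_solvable a h F g (max_delay \<tau> \<sigma>)"
    and M_mat: "M_matrix (stability_matrix \<alpha> A \<tau> L)"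
  shows "globally_exponentially_stable N a h F g (max_delay \<tau> \<sigma>)"
proof -
  let ?s = "max_delay \<tau> \<sigma>"
  obtain d :: "real^'n" where d_pos: "\<And>i. d $ i > 0"
    and Cd_pos: "\<And>i. (stability_matrix \<alpha> A \<tau> L *v d) $ i > 0"
    using M_matrix_obtain_positive_vector[OF M_mat] by blast
  define \<rho> where "\<rho> = (\<lambda>i. A i * \<tau> i * (A i * d $ i + (\<Sum>j\<in>UNIV. L i j * d $ j)) + (\<Sum>j\<in>UNIV. L i j * d $ j))"
  have \<rho>_less: "\<rho> i < \<alpha> i * d $ i" for i
    using mult_pos_pos[OF constants(1)[of i] Cd_pos[of i]] stability_matrix_row[of \<alpha> i A \<tau> L d, OF constants(1)]
    by (simp add: \<rho>_def)
  obtain \<gamma> where "\<gamma> > 0" and \<gamma>: "\<And>i. exp (2 * \<gamma> * ?s) * \<rho> i < (\<alpha> i - \<gamma>) * d $ i"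
    using obtain_decay_rate[of \<rho> \<alpha> "\<lambda>i. d $ i" ?s, OF \<rho>_less] by metis
  obtain B where "B > 0" and B: "\<And>x i. \<bar>x $ i\<bar> \<le> B * N x"
    using is_norm_dominates_components[OF norm] by blast
  have "\<exists>K. \<forall>i. 1 < K * d $ i \<and> 2 * A i * exp (\<gamma> * ?s) < K * ((\<alpha> i - \<gamma>) * d $ i - exp (2 * \<gamma> * ?s) * \<rho> i)"
  proof -
    have large: "\<forall>\<^sub>F K in at_top. x < K * y" if "y > 0" for x y :: real
      using eventually_gt_at_top[of "x / y"] by eventually_elim (use that in \<open>simp add: field_simps\<close>)
    have "\<forall>\<^sub>F K in at_top. \<forall>i. 1 < K * d $ i \<and>
        2 * A i * exp (\<gamma> * ?s) < K * ((\<alpha> i - \<gamma>) * d $ i - exp (2 * \<gamma> * ?s) * \<rho> i)"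
      by (intro eventually_all_finite eventually_conj large) (use d_pos \<gamma> in auto)
    then show ?thesis using eventually_happens' trivial_limit_at_top_linorder by blast
  qed
  then obtain K where K1: "\<And>i. 1 < K * d $ i"
    and K2: "\<And>i. 2 * A i * exp (\<gamma> * ?s) < K * ((\<alpha> i - \<gamma>) * d $ i - exp (2 * \<gamma> * ?s) * \<rho> i)"
    by blast
  have "0 < K" using K1[of undefined] d_pos[of undefined]
    by (metis less_trans zero_less_mult_pos2 zero_less_one)
  \<comment> \<open>The summand \<open>1\<close> is there only to make positivity of \<open>M\<close>
    immediate.\<close>
  define M where "M = (\<Sum>i\<in>UNIV. K * B * d $ i * N (axis i 1)) + 1"
  have "M > 0"
    unfolding M_def using \<open>0 < K\<close> \<open>0 < B\<close> d_pos is_norm_nonneg[OF norm]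
    by (intro add_nonneg_pos sum_nonneg mult_nonneg_nonneg) (auto simp: less_imp_le)
  have "N (X t) \<le> M * exp (- \<gamma> * (t - t0)) * (N (X t0) + sup_on {t0 - ?s..<t0} (\<lambda>u. N (\<phi> u)))"
    if "t0 \<ge> 0" and \<phi>: "continuous_on {t0 - ?s..t0} \<phi>" and X: "is_solution a h F g ?s t0 \<phi> X" and "t \<ge> t0"
    for t0 \<phi> X t
  proof -
    define \<Phi> where "\<Phi> = N (X t0) + sup_on {t0 - ?s..<t0} (\<lambda>u. N (\<phi> u))"
    have "compact ((\<lambda>u. N (\<phi> u)) ` {t0 - ?s..t0})"
      by (intro compact_continuous_image continuous_on_compose2[OF is_norm_continuous_on[OF norm] \<phi>]) auto
    then have "bdd_above ((\<lambda>u. N (\<phi> u)) ` {t0 - ?s..t0})"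
      by (intro bounded_imp_bdd_above compact_imp_bounded)
    then have bdd: "bdd_above ((\<lambda>u. N (\<phi> u)) ` {t0 - ?s..<t0})"
      by (rule bdd_above_mono) auto
    have sup_ge: "N (\<phi> u) \<le> sup_on {t0 - ?s..<t0} (\<lambda>u. N (\<phi> u))" if "t0 - ?s \<le> u" "u < t0" for u
      using le_sup_on[OF bdd] that by simp
    have sup_nonneg: "0 \<le> sup_on {t0 - ?s..<t0} (\<lambda>u. N (\<phi> u))"
    proof (cases "{t0 - ?s..<t0} = {}")
      case True
      then show ?thesis by (simp add: sup_on_def)
    next
      case False
      then have "t0 - ?s < t0" by simp
      with sup_ge[of "t0 - ?s"] show ?thesis using is_norm_nonneg[OF norm] order_trans by auto
    qed
    then have "0 \<le> \<Phi>" using is_norm_nonneg[OF norm] by (simp add: \<Phi>_def)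
    have history: "\<bar>X u $ i\<bar> \<le> B * \<Phi>" if "t0 - ?s \<le> u" "u \<le> t0" for u i
    proof -
      have "N (X u) \<le> \<Phi>"
      proof (cases "u = t0")
        case True
        then show ?thesis using sup_nonneg by (simp add: \<Phi>_def)
      next
        case False
        moreover have "X u = \<phi> u" using X that by (simp add: is_solution_def)
        ultimately show ?thesis using sup_ge[of u] that is_norm_nonneg[OF norm, of "X t0"]
          by (simp add: \<Phi>_def)
      qed
      then have "B * N (X u) \<le> B * \<Phi>" using \<open>B > 0\<close> by simp
      with B[of "X u" i] show ?thesis by linarith
    qed
    \<comment> \<open>The comparison needs a positive bound on the history, but \<open>B * \<Phi>\<close> may
      vanish; it is enlarged slightly, by an amount that contributes \<open>e\<close>.\<close>
    have decay: "\<bar>X t $ i\<bar> \<le> K * (B * \<Phi>) * d $ i * exp (- \<gamma> * (t - t0))" for i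
    proof (rule field_le_epsilon)
      fix e :: real assume "e > 0"
      define w where "w = K * d $ i * exp (- \<gamma> * (t - t0))"
      have "w > 0" using \<open>K > 0\<close> d_pos by (simp add: w_def)
      define P where "P = B * \<Phi> + e / w"
      have "e / w > 0" using \<open>e > 0\<close> \<open>w > 0\<close> by simp
      then have "0 < P" and P: "B * \<Phi> \<le> P"
        unfolding P_def using \<open>B > 0\<close> \<open>0 \<le> \<Phi>\<close> by (auto intro: add_nonneg_pos)
      have "\<bar>X t $ i\<bar> < K * P * d $ i * exp (- \<gamma> * (t - t0))"
      proof (rule solution_decay[where \<alpha> = \<alpha> and A = A and \<tau> = \<tau> and \<sigma> = \<sigma> and L = L])
        show "K * exp (2 * \<gamma> * ?s) * (A i * \<tau> i * (A i * d $ i + (\<Sum>j\<in>UNIV. L i j * d $ j))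
            + (\<Sum>j\<in>UNIV. L i j * d $ j)) + 2 * A i * exp (\<gamma> * ?s) < K * (\<alpha> i - \<gamma>) * d $ i" for i
          using K2[of i] by (simp add: \<rho>_def algebra_simps)
        show "\<bar>X u $ i\<bar> \<le> P" if "t0 - ?s \<le> u" "u \<le> t0" for u i
          using history[OF that, of i] P by linarith
      qed (fact constants a_bounds F_bound h_delay g_delay max_delay_ge d_pos \<open>\<gamma> > 0\<close> K1 X \<open>t0 \<ge> 0\<close> \<open>0 < P\<close> \<open>t \<ge> t0\<close>)+
      also have "K * P * d $ i * exp (- \<gamma> * (t - t0)) = K * (B * \<Phi>) * d $ i * exp (- \<gamma> * (t - t0)) + e"
      proof -
        have "K * P * d $ i * exp (- \<gamma> * (t - t0)) = w * P" by (simp add: w_def)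
        also have "\<dots> = w * (B * \<Phi>) + e" using \<open>w > 0\<close> by (simp add: P_def field_simps)
        finally show ?thesis by (simp add: w_def algebra_simps)
      qed
      finally show "\<bar>X t $ i\<bar> \<le> K * (B * \<Phi>) * d $ i * exp (- \<gamma> * (t - t0)) + e" by simp
    qed
    have "N (X t) \<le> (\<Sum>i\<in>UNIV. \<bar>X t $ i\<bar> * N (axis i 1))"
      by (rule is_norm_le_sum_components[OF norm])
    also have "\<dots> \<le> (\<Sum>i\<in>UNIV. (K * (B * \<Phi>) * d $ i * exp (- \<gamma> * (t - t0))) * N (axis i 1))"
      by (intro sum_mono mult_right_mono decay is_norm_nonneg[OF norm])
    also have "\<dots> = (M - 1) * exp (- \<gamma> * (t - t0)) * \<Phi>"
      unfolding M_def by (simp add: sum_distrib_left sum_distrib_right algebra_simps)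
    also have "\<dots> \<le> M * exp (- \<gamma> * (t - t0)) * \<Phi>"
      using \<open>0 \<le> \<Phi>\<close> by (intro mult_right_mono) auto
    finally show ?thesis by (simp add: \<Phi>_def)
  qed
  with \<open>M > 0\<close> \<open>\<gamma> > 0\<close> show ?thesis
    unfolding globally_exponentially_stable_def by blast
qed

end
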